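(* For every integer $k\ge 2$, $$\sup_{n\ge 1}\mathrm{HGP}(B_{k,n})=C_k .$$ Moreover, there is an integer $N_k<\infty$ such that $\mathrm{HGP}(B_{k,n})=C_k$ for every $n\ge N_k$.
   Context: Proper hat-guessing game: let $G=(V,E)$ be a finite simple graph and $[q]=\{0,1,\dots,q-1\}$. Before play, the vertices agree on deterministic guess functions; the guess of each vertex is a function of the colors on its open neighborhood, with values in $[q]$. An adversary assigns a color from $[q]$ to every vertex so that adjacent vertices get distinct colors (a proper $q$-coloring). All vertices simultaneously guess their own colors. A strategy (family of guess functions) is winning with $q$ colors if for every proper $q$-coloring at least one vertex guesses its own color correctly. The proper hat-guessing number $\mathrm{HGP}(G)$ is the largest $q$ for which a winning strategy exists. The book graph is $B_{k,n}=K_k\vee\overline{K_n}$ (join): $k$ mutually adjacent vertices (spines) and $n$ pairwise nonadjacent vertices (pages), every page adjacent to every spine. A proper $k$-tuple is a $k$-tuple $\boldsymbol{x}=(x_1,\dots,x_k)$ of pairwise distinct colors; a configuration is a set $P$ of proper $k$-tuples, with colors drawn from some finite set. Let $\pi_i(\boldsymbol{x})$ be the $(k-1)$-tuple obtained by deleting coordinate $i$. A set $A$ of proper $k$-tuples is $i$-saturated if $\pi_i$ restricted to $A$ is injective. A configuration $P$ is coverable if it can be partitioned as $P=P_1\,\dot\cup\cdots\dot\cup\,P_k$ (parts may be empty) with $P_i$ being $i$-saturated for every $i$. Let $\mathrm{supp}(P)=\bigcup_{\boldsymbol{x}\in P}\{x_1,\dots,x_k\}$. Define $$C_k=\min\{|P|+|\mathrm{supp}(P)|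 : P \text{ is a finite non-coverable configuration of proper } k\text{-tuples}\},$$ where the colors may be drawn from any finite set. *)

theory Defs
  imports Complex_Main "HOL-Library.FuncSet" "HOL-Library.Disjoint_Sets"
    "HOL-Library.Extended_Nat"
begin

text \<open>A graph is a pair of a vertex set and a symmetric, irreflexive set of ordered pairs.\<close>

type_synonym 'v graph = "'v set \<times> ('v \<times> 'v) set"

abbreviation verts :: "'v graph \<Rightarrow> 'v set" where
  "verts G \<equiv> fst G"

abbreviation edges :: "'v graph \<Rightarrow> ('v \<times> 'v) set" where
  "edges G \<equiv> snd G"

definition finite_simple_graph :: "'v graph \<Rightarrow> bool" where
  "finite_simple_graph G \<longleftrightarrow>
     finite (verts G) \<and> edges G \<subseteq> verts G \<times> verts G \<and> sym (edges G) \<and> irrefl (edges G)"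

definition nbhd :: "'v graph \<Rightarrow> 'v \<Rightarrow> 'v set" where
  "nbhd G v = {u. (v, u) \<in> edges G}"

definition proper_colouring :: "'v graph \<Rightarrow> nat \<Rightarrow> ('v \<Rightarrow> nat) \<Rightarrow> bool" where
  "proper_colouring G q c \<longleftrightarrow>
     c \<in> verts G \<rightarrow>\<^sub>E {..<q} \<and> (\<forall>(u, v) \<in> edges G. c u \<noteq> c v)"

definition strategy :: "'v graph \<Rightarrow> nat \<Rightarrow> ('v \<Rightarrow> ('v \<Rightarrow> nat) \<Rightarrow> nat) \<Rightarrow> bool" where
  "strategy G q g \<longleftrightarrow> (\<forall>v \<in> verts G. g v \<in> (nbhd G v \<rightarrow>\<^sub>E {..<q}) \<rightarrow> {..<q})"

definition winning :: "'v graph \<Rightarrow> nat \<Rightarrow> ('v \<Rightarrow> ('v \<Rightarrow> nat) \<Rightarrow> nat) \<Rightarrow> bool" where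
  "winning G q g \<longleftrightarrow>
     (\<forall>c. proper_colouring G q c \<longrightarrow> (\<exists>v \<in> verts G. g v (restrict c (nbhd G v)) = c v))"

text \<open>The supremum is taken in the extended naturals, so that it is \<open>\<infinity>\<close>, and not an arbitrary
  number, if there is no largest \<open>q\<close>. A finite nonzero value is attained.\<close>

definition HGP :: "'v graph \<Rightarrow> enat" where
  "HGP G = Sup {enat q |q. \<exists>g. strategy G q g \<and> winning G q g}"

definition complete_graph :: "nat \<Rightarrow> nat graph" where
  "complete_graph k = ({..<k}, {(i, j). i < k \<and> j < k \<and> i \<noteq> j})"

definition edgeless_graph :: "nat \<Rightarrow> nat graph" where
  "edgeless_graph n = ({..<n}, {})"

definition graph_join :: "'a graph \<Rightarrow> 'b graph \<Rightarrow> ('a + 'b) graph" where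
  "graph_join G H =
     (verts G <+> verts H,
      map_prod Inl Inl ` edges G \<union> map_prod Inr Inr ` edges H \<union>
      Inl ` verts G \<times> Inr ` verts H \<union> Inr ` verts H \<times> Inl ` verts G)"

definition book :: "nat \<Rightarrow> nat \<Rightarrow> (nat + nat) graph" where
  "book k n = graph_join (complete_graph k) (edgeless_graph n)"

lemma finite_simple_graph_book: "finite_simple_graph (book k n)"
  by (auto simp: finite_simple_graph_def book_def graph_join_def complete_graph_def
      edgeless_graph_def sym_def irrefl_def)

text \<open>Tuples are lists, with coordinates numbered from \<open>0\<close>.\<close>

definition configuration :: "nat \<Rightarrow> 'a list set \<Rightarrow> bool" where
  "configuration k P \<longleftrightarrow> (\<forall>x \<in> P. length x = k \<and> distinct x)"

definition delete_coord :: "nat \<Rightarrow> 'a list \<Rightarrow> 'a list" where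
  "delete_coord i x = take i x @ drop (Suc i) x"

definition saturated :: "nat \<Rightarrow> 'a list set \<Rightarrow> bool" where
  "saturated i A \<longleftrightarrow> inj_on (delete_coord i) A"

definition coverable :: "nat \<Rightarrow> 'a list set \<Rightarrow> bool" where
  "coverable k P \<longleftrightarrow>
     (\<exists>Q. P = (\<Union>i<k. Q i) \<and> disjoint_family_on Q {..<k} \<and> (\<forall>i<k. saturated i (Q i)))"

definition supp :: "'a list set \<Rightarrow> 'a set" where
  "supp P = (\<Union>x \<in> P. set x)"

text \<open>Colours are natural numbers, which loses no generality: only finite configurations count,
  and every finite set of colours embeds into the naturals. The minimum is over a nonempty set for
  \<open>k \<ge> 1\<close>, see \<open>non_coverable_exists\<close> below.\<close>

definition C :: "nat \<Rightarrow> nat" where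
  "C k = (LEAST m. \<exists>P :: nat list set.
     configuration k P \<and> finite P \<and> \<not> coverable k P \<and> m = card P + card (supp P))"

lemma non_coverable_exists:
  assumes "k \<ge> 1"
  shows "\<exists>P :: nat list set. configuration k P \<and> finite P \<and> \<not> coverable k P"
proof -
  define T :: "nat \<Rightarrow> nat list set" where
    "T m = {xs. length xs = m \<and> distinct xs \<and> set xs \<subseteq> {..<2 * k}}" for m
  have cardT: "card (T m) = \<Prod>{2 * k - m + 1..2 * k}" if "m \<le> 2 * k" for m
    unfolding T_def using card_lists_distinct_length_eq[of "{..<2 * k}" m] that by simp
  have finT: "finite (T m)" for m
    by (rule finite_subset[OF _ finite_lists_length_eq[of "{..<2 * k}" m]]) (auto simp: T_def)
  have del: "delete_coord i x \<in> T (k - 1)" if "i < k" "x \<in> T k" for i x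
    using that set_take_disj_set_drop_if_distinct[of x i "Suc i"]
    by (auto simp: T_def delete_coord_def dest: in_set_takeD in_set_dropD)
  have "\<not> coverable k (T k)"
  proof
    assume "coverable k (T k)"
    then obtain Q where Q: "T k = (\<Union>i<k. Q i)" "\<forall>i<k. saturated i (Q i)"
      by (auto simp: coverable_def)
    have "card (Q i) \<le> card (T (k - 1))" if "i < k" for i
    proof (rule card_inj_on_le[of "delete_coord i"])
      show "inj_on (delete_coord i) (Q i)"
        using Q(2) that by (simp add: saturated_def)
      have "Q i \<subseteq> T k"
        using Q(1) that by blast
      then show "delete_coord i ` Q i \<subseteq> T (k - 1)"
        using del[OF that] by blast
    qed (rule finT)
    then have "(\<Sum>i<k. card (Q i)) \<le> k * card (T (k - 1))"
      using sum_bounded_above[of "{..<k}" "\<lambda>i. card (Q i)" "card (T (k - 1))"] by simp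
    moreover have "card (T k) \<le> (\<Sum>i<k. card (Q i))"
      unfolding Q(1) by (rule card_UN_le) simp
    moreover have "card (T k) = Suc k * card (T (k - 1))"
    proof -
      have "{k + 1..2 * k} = insert (Suc k) {k + 2..2 * k}"
        using assms by auto
      then show ?thesis
        using assms by (simp add: cardT Suc_diff_le)
    qed
    moreover have "card (T (k - 1)) > 0"
      using assms by (subst cardT) (auto intro!: prod_pos)
    ultimately show False by simp
  qed
  then show ?thesis
    using finT[of k] by (intro exI[of _ "T k"]) (auto simp: configuration_def T_def)
qed

end

theory Submission
  imports Defs
begin

text \<open>Fix the colours of the pages. The spine tuples on which spine \<open>i\<close> can guess correctly form an
  \<open>i\<close>-saturated set, so the spines can handle exactly the coverable configurations.

  Upper bound: against a non-coverable \<open>P\<close> with \<open>card P + card (supp P) < q\<close>, every page can be given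
  a colour that avoids \<open>supp P\<close> and all its guesses on \<open>P\<close>, and then some tuple of \<open>P\<close> defeats
  the spines.

  Lower bound: let \<open>q = C k\<close> and let every function from tuples to colours be the guess function
  of some page. The set \<open>R\<close> of spine tuples on which no page is right is coverable. Otherwise
  \<open>card R + card (supp R) \<ge> q\<close>, so some page guesses, on \<open>R\<close>, every colour outside \<open>supp R\<close>,
  and no colour is left for that page.\<close>

section \<open>Deleted coordinates and coverability\<close>

text \<open>Deletion shifts the later coordinates down by one; comparing the \<open>take\<close> and
  \<open>drop\<close> pieces separately undoes the shift. This links saturation to what spine
  \<open>i\<close> sees of the other spines.\<close>

lemma delete_coord_eq_iff:
  assumes "length x = k" "length y = k" "i < k"
  shows "delete_coord i x = delete_coord i y \<longleftrightarrow> (\<forall>j<k. j \<noteq> i \<longrightarrow> x ! j = y ! j)"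
proof -
  have "delete_coord i x = delete_coord i y \<longleftrightarrow>
      take i x = take i y \<and> drop (Suc i) x = drop (Suc i) y"
    using assms by (simp add: delete_coord_def)
  also have "take i x = take i y \<longleftrightarrow> (\<forall>j<i. x ! j = y ! j)"
    using assms by (auto simp: list_eq_iff_nth_eq)
  also have "drop (Suc i) x = drop (Suc i) y \<longleftrightarrow> (\<forall>j<k. i < j \<longrightarrow> x ! j = y ! j)"
  proof -
    have "(\<forall>m<k - Suc i. x ! (Suc i + m) = y ! (Suc i + m)) \<longleftrightarrow> (\<forall>j<k. i < j \<longrightarrow> x ! j = y ! j)"
    proof (intro iffI allI impI)
      fix j
      assume *: "\<forall>m<k - Suc i. x ! (Suc i + m) = y ! (Suc i + m)" and "j < k" "i < j"
      then show "x ! j = y ! j"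
        using *[rule_format, of "j - Suc i"] by simp
    qed auto
    then show ?thesis
      using assms by (simp add: list_eq_iff_nth_eq)
  qed
  finally show ?thesis
    using assms(3) less_trans[OF _ assms(3)] by (auto simp: nat_neq_iff)
qed

lemma saturated_subset: "saturated i A \<Longrightarrow> B \<subseteq> A \<Longrightarrow> saturated i B"
  unfolding saturated_def by (rule inj_on_subset)

text \<open>Disjointness comes for free: \<open>disjointed\<close> removes the earlier sets from
  each \<open>A i\<close>, and saturation passes to subsets.\<close>

lemma coverableI:
  assumes "P = (\<Union>i<k. A i)" and "\<And>i. i < k \<Longrightarrow> saturated i (A i)"
  shows "coverable k P"
  unfolding coverable_def
proof (intro exI conjI allI impI)
  show "P = (\<Union>i<k. disjointed A i)"
    using assms(1) finite_UN_disjointed_eq[of A k] by (simp add: atLeast0LessThan)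
  show "disjoint_family_on (disjointed A) {..<k}"
    using disjoint_family_disjointed by (rule disjoint_family_on_mono[rotated]) simp
  show "saturated i (disjointed A i)" if "i < k" for i
    using assms(2)[OF that] disjointed_subset by (rule saturated_subset)
qed

lemma not_coverable_nonempty: "\<not> coverable k P \<Longrightarrow> P \<noteq> {}"
  using coverableI[of P "\<lambda>_. {}" k] by (auto simp: saturated_def)

section \<open>The minimum defining \<open>C\<close>\<close>

lemma C_attained:
  assumes "k \<ge> 1"
  obtains P :: "nat list set" where "configuration k P" "finite P" "\<not> coverable k P"
    "C k = card P + card (supp P)"
proof -
  have "\<exists>m. \<exists>P :: nat list set.
      configuration k P \<and> finite P \<and> \<not> coverable k P \<and> m = card P + card (supp P)"
    using non_coverable_exists[OF assms] by blast
  from LeastI_ex[OF this] show thesis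
    using that unfolding C_def by blast
qed

lemma C_le:
  fixes P :: "nat list set"
  assumes "configuration k P" "finite P" "\<not> coverable k P"
  shows "C k \<le> card P + card (supp P)"
  unfolding C_def using assms by (blast intro: Least_le)

lemma C_pos: "k \<ge> 1 \<Longrightarrow> C k > 0"
  by (metis C_attained add_gr_0 card_gt_0_iff not_coverable_nonempty)

lemma finite_supp: "finite P \<Longrightarrow> finite (supp P)"
  by (simp add: supp_def)

section \<open>Vertices, neighbourhoods and proper colourings of the book graph\<close>

lemma verts_book: "verts (book k n) = Inl ` {..<k} \<union> Inr ` {..<n}"
  by (auto simp: book_def graph_join_def complete_graph_def edgeless_graph_def)

lemma nbhd_spine: "i < k \<Longrightarrow> nbhd (book k n) (Inl i) = Inl ` ({..<k} - {i}) \<union> Inr ` {..<n}"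
  by (auto simp: nbhd_def book_def graph_join_def complete_graph_def edgeless_graph_def)

lemma nbhd_page: "j < n \<Longrightarrow> nbhd (book k n) (Inr j) = Inl ` {..<k}"
  by (auto simp: nbhd_def book_def graph_join_def complete_graph_def edgeless_graph_def)

lemma proper_colouring_book_iff:
  "proper_colouring (book k n) q c \<longleftrightarrow> c \<in> verts (book k n) \<rightarrow>\<^sub>E {..<q} \<and>
     (\<forall>i<k. \<forall>j<k. i \<noteq> j \<longrightarrow> c (Inl i) \<noteq> c (Inl j)) \<and> (\<forall>i<k. \<forall>j<n. c (Inl i) \<noteq> c (Inr j))"
proof -
  have "edges (book k n) = (\<lambda>(i, j). (Inl i, Inl j)) ` {(i, j). i < k \<and> j < k \<and> i \<noteq> j} \<union>
      Inl ` {..<k} \<times> Inr ` {..<n} \<union> Inr ` {..<n} \<times> Inl ` {..<k}"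
    by (auto simp: book_def graph_join_def complete_graph_def edgeless_graph_def)
  then have "(\<forall>(u, v) \<in> edges (book k n). c u \<noteq> c v) \<longleftrightarrow>
     (\<forall>i<k. \<forall>j<k. i \<noteq> j \<longrightarrow> c (Inl i) \<noteq> c (Inl j)) \<and>
     (\<forall>i<k. \<forall>j<n. c (Inl i) \<noteq> c (Inr j)) \<and> (\<forall>j<n. \<forall>i<k. c (Inr j) \<noteq> c (Inl i))"
    by (simp only: ball_Un) auto
  also have "(\<forall>j<n. \<forall>i<k. c (Inr j) \<noteq> c (Inl i)) \<longleftrightarrow> (\<forall>i<k. \<forall>j<n. c (Inl i) \<noteq> c (Inr j))"
    by metis
  finally have "(\<forall>(u, v) \<in> edges (book k n). c u \<noteq> c v) \<longleftrightarrow>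
     (\<forall>i<k. \<forall>j<k. i \<noteq> j \<longrightarrow> c (Inl i) \<noteq> c (Inl j)) \<and> (\<forall>i<k. \<forall>j<n. c (Inl i) \<noteq> c (Inr j))"
    by blast
  then show ?thesis
    by (simp add: proper_colouring_def)
qed

section \<open>Upper bound: the adversary's colouring\<close>

lemma winning_book_le_C:
  assumes k: "k \<ge> 1" and win: "winning (book k n) q g"
  shows "q \<le> C k"
proof (rule ccontr)
  assume "\<not> q \<le> C k"
  then have q: "C k < q"
    by simp
  obtain P :: "nat list set" where P: "configuration k P" "finite P" "\<not> coverable k P"
    and CP: "C k = card P + card (supp P)"
    using C_attained[OF k] .
  have len: "length x = k" and dist: "distinct x" if "x \<in> P" for x
    using P(1) that by (auto simp: configuration_def)
  have in_supp: "x ! i \<in> supp P" if "x \<in> P" "i < k" for x i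
    using that len nth_mem unfolding supp_def by blast
  \<comment> \<open>The colours of \<open>P\<close> are arbitrary naturals, so they are relabelled
    injectively by \<open>q\<close> colours; there is room since
    \<open>card (supp P) < q\<close>.\<close>
  obtain h where h: "h ` supp P \<subseteq> {..<q}" "inj_on h (supp P)"
    using card_le_inj[of "supp P" "{..<q}"] finite_supp[OF P(2)] q CP by auto
  define spines :: "nat list \<Rightarrow> nat + nat \<Rightarrow> nat"
    where "spines x = (\<lambda>v \<in> Inl ` {..<k}. case_sum (\<lambda>i. h (x ! i)) (\<lambda>_. 0) v)" for x
  \<comment> \<open>All tuples of \<open>P\<close> are excluded at once, so the colour of page
    \<open>j\<close> can be fixed before the adversary picks a tuple.\<close>
  have "\<exists>p<q. p \<notin> h ` supp P \<union> (\<lambda>x. g (Inr j) (spines x)) ` P" for j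
  proof -
    have "card (h ` supp P \<union> (\<lambda>x. g (Inr j) (spines x)) ` P) \<le> card (supp P) + card P"
      by (rule order_trans[OF card_Un_le])
        (intro add_mono card_image_le finite_supp P(2))
    then have "\<not> {..<q} \<subseteq> h ` supp P \<union> (\<lambda>x. g (Inr j) (spines x)) ` P"
      using q CP P(2) finite_supp[OF P(2)]
        card_mono[of "h ` supp P \<union> (\<lambda>x. g (Inr j) (spines x)) ` P" "{..<q}"] by auto
    then show ?thesis
      by blast
  qed
  then obtain p where p: "\<And>j. p j < q" "\<And>j. p j \<notin> h ` supp P"
    "\<And>j x. x \<in> P \<Longrightarrow> p j \<noteq> g (Inr j) (spines x)"
    by (metis UnCI image_eqI)
  define col where "col x = restrict (case_sum (\<lambda>i. h (x ! i)) p) (verts (book k n))" for x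
  have col_spine: "col x (Inl i) = h (x ! i)" if "i < k" for x i
    using that by (simp add: col_def verts_book)
  have col_page: "col x (Inr j) = p j" if "j < n" for x j
    using that by (simp add: col_def verts_book)
  have proper: "proper_colouring (book k n) q (col x)" if x: "x \<in> P" for x
    unfolding proper_colouring_book_iff
  proof (intro conjI allI impI)
    show "col x \<in> verts (book k n) \<rightarrow>\<^sub>E {..<q}"
      using subsetD[OF h(1) imageI[OF in_supp[OF x]]] p(1) by (auto simp: col_def verts_book)
    show "col x (Inl i) \<noteq> col x (Inl j)" if "i < k" "j < k" "i \<noteq> j" for i j
      using that in_supp[OF x] inj_onD[OF h(2)] len[OF x] dist[OF x]
      by (metis col_spine nth_eq_iff_index_eq)
    show "col x (Inl i) \<noteq> col x (Inr j)" if "i < k" "j < n" for i j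
      using that p(2)[of j] imageI[OF in_supp[OF x], of i h] by (auto simp: col_spine col_page)
  qed
  define A where "A i = {x \<in> P. g (Inl i) (restrict (col x) (nbhd (book k n) (Inl i))) = h (x ! i)}"
    for i
  have "x \<in> (\<Union>i<k. A i)" if x: "x \<in> P" for x
  proof -
    obtain v where v: "v \<in> verts (book k n)"
        "g v (restrict (col x) (nbhd (book k n) v)) = col x v"
      using win proper[OF x] by (auto simp: winning_def)
    show ?thesis
    proof (cases v)
      case (Inl i)
      then show ?thesis
        using v x col_spine by (auto simp: A_def verts_book)
    next
      case (Inr j)
      have "j < n"
        using v(1) Inr by (auto simp: verts_book)
      \<comment> \<open>A correct page is impossible: it sees exactly \<open>spines x\<close>, and
        \<open>p j\<close> was chosen to differ from its guess there.\<close>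
      moreover have "restrict (col x) (Inl ` {..<k}) = spines x"
        by (auto simp: spines_def col_spine fun_eq_iff restrict_def)
      ultimately show ?thesis
        using v(2) Inr p(3)[OF x, of j] by (simp add: nbhd_page col_page)
    qed
  qed
  moreover have "saturated i (A i)" if i: "i < k" for i
    unfolding saturated_def
  proof (rule inj_onI)
    fix x y
    assume x: "x \<in> A i" and y: "y \<in> A i" and eq: "delete_coord i x = delete_coord i y"
    have xP: "x \<in> P" and yP: "y \<in> P"
      using x y by (auto simp: A_def)
    have others: "\<forall>j<k. j \<noteq> i \<longrightarrow> x ! j = y ! j"
      using eq delete_coord_eq_iff[OF len[OF xP] len[OF yP] i] by simp
    \<comment> \<open>The page colours do not depend on the tuple, so spine \<open>i\<close> has the
      same view, hence the same guess, on \<open>x\<close> and \<open>y\<close>.\<close>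
    then have "restrict (col x) (nbhd (book k n) (Inl i)) = restrict (col y) (nbhd (book k n) (Inl i))"
      by (auto simp: nbhd_spine[OF i] col_spine col_page fun_eq_iff restrict_def)
    then have "h (x ! i) = h (y ! i)"
      using x y by (simp add: A_def)
    then have "x ! i = y ! i"
      using inj_onD[OF h(2)] in_supp xP yP i by blast
    then show "x = y"
      using others len[OF xP] len[OF yP] by (metis nth_equalityI)
  qed
  moreover have "(\<Union>i<k. A i) \<subseteq> P"
    by (auto simp: A_def)
  ultimately have "coverable k P"
    by (intro coverableI[of P A k]) auto
  with P(3) show False
    by simp
qed

section \<open>Lower bound: a winning strategy for many pages\<close>

text \<open>Embed \<open>Z\<close> into \<open>R\<close> and invert the embedding on its image;
  elsewhere a fixed value of \<open>Y\<close> is taken. It supplies the page whose guesses on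
  \<open>R\<close> exhaust the colours outside \<open>supp R\<close>.\<close>

lemma ex_PiE_covering:
  assumes "R \<subseteq> T" "finite R" "finite Z" "card Z \<le> card R" "Z \<subseteq> Y" "Y \<noteq> {}"
  obtains f where "f \<in> T \<rightarrow>\<^sub>E Y" "Z \<subseteq> f ` R"
proof -
  obtain u where u: "u ` Z \<subseteq> R" "inj_on u Z"
    using card_le_inj[OF assms(3,2,4)] by blast
  obtain y where y: "y \<in> Y"
    using assms(6) by blast
  define f where "f = (\<lambda>x\<in>T. if x \<in> u ` Z then the_inv_into Z u x else y)"
  have inv: "the_inv_into Z u (u z) = z" if "z \<in> Z" for z
    using the_inv_into_f_f[OF u(2) that] .
  show thesis
  proof
    show "f \<in> T \<rightarrow>\<^sub>E Y"
      using y subsetD[OF assms(5)] by (auto simp: f_def inv)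
    show "Z \<subseteq> f ` R"
    proof
      fix z
      assume z: "z \<in> Z"
      then have "u z \<in> R" "f (u z) = z"
        using u(1) assms(1) by (auto simp: f_def inv)
      then show "z \<in> f ` R"
        by (metis image_eqI)
    qed
  qed
qed

lemma winning_book_C:
  assumes k: "k \<ge> 1"
  shows "\<exists>N. \<forall>n\<ge>N. \<exists>g. strategy (book k n) (C k) g \<and> winning (book k n) (C k) g"
proof -
  define q where "q = C k"
  have q: "0 < q"
    using C_pos[OF k] by (simp add: q_def)
  define T where "T = {x. length x = k \<and> distinct x \<and> set x \<subseteq> {..<q}}"
  have finT: "finite T"
    by (rule finite_subset[OF _ finite_lists_length_eq[of "{..<q}" k]]) (auto simp: T_def)
  define F where "F = T \<rightarrow>\<^sub>E {..<q}"
  define N where "N = card F"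
  have "finite F"
    unfolding F_def using finT by (intro finite_PiE) auto
  \<comment> \<open>Page \<open>j\<close> will guess by the function \<open>e j\<close>, so the
    first \<open>N\<close> pages realise all of \<open>F\<close>.\<close>
  then obtain e where "bij_betw e {0..<N} F"
    unfolding N_def using ex_bij_betw_nat_finite by blast
  then have e: "e ` {..<N} = F"
    by (simp add: bij_betw_def atLeast0LessThan)
  have eF: "e j x < q" if "j < N" "x \<in> T" for j x
    using e that by (force simp: F_def)
  define R where "R p = {x \<in> T. \<forall>j<N. p j \<notin> set x \<and> e j x \<noteq> p j}" for p
  have cov: "coverable k (R p)" if p: "\<forall>j<N. p j < q" for p
  proof (rule ccontr)
    assume "\<not> coverable k (R p)"
    moreover have RT: "R p \<subseteq> T"
      by (auto simp: R_def)
    moreover have finR: "finite (R p)"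
      using finT RT by (rule finite_subset[rotated])
    moreover have "configuration k (R p)"
      using RT by (auto simp: configuration_def T_def)
    ultimately have le: "q \<le> card (R p) + card (supp (R p))"
      unfolding q_def by (intro C_le)
    have "supp (R p) \<subseteq> {..<q}"
      using RT by (auto simp: supp_def T_def)
    then have "card ({..<q} - supp (R p)) \<le> card (R p)"
      using le by (simp add: card_Diff_subset finite_supp[OF finR])
    then obtain f where f: "f \<in> F" "{..<q} - supp (R p) \<subseteq> f ` R p"
      unfolding F_def
      using ex_PiE_covering[OF RT finR, of "{..<q} - supp (R p)" "{..<q}"] q by auto
    obtain j where j: "j < N" "e j = f"
      using f(1) e by auto
    \<comment> \<open>No tuple in \<open>R p\<close> contains \<open>p j\<close>, and page
      \<open>j\<close> is wrong on each of them; yet \<open>f\<close> takes every colour outside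
      \<open>supp (R p)\<close>.\<close>
    have "p j \<notin> supp (R p)" "p j \<notin> f ` R p"
      using j by (auto simp: supp_def R_def)
    then show False
      using f(2) p j(1) by auto
  qed
  \<comment> \<open>The cover is chosen as a function of \<open>p\<close> alone. Every spine sees
    all the pages, so all spines agree on the same cover.\<close>
  have "\<exists>Q. (\<forall>j<N. p j < q) \<longrightarrow> R p = (\<Union>i<k. Q i) \<and> (\<forall>i<k. saturated i (Q i))" for p
    using cov[of p] unfolding coverable_def by blast
  then obtain Q where Q: "\<And>p. \<forall>j<N. p j < q \<Longrightarrow> R p = (\<Union>i<k. Q p i)"
    "\<And>p i. \<forall>j<N. p j < q \<Longrightarrow> i < k \<Longrightarrow> saturated i (Q p i)"
    by metis
  define agrees :: "nat \<Rightarrow> nat list \<Rightarrow> (nat + nat \<Rightarrow> nat) \<Rightarrow> bool"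
    where "agrees i x d \<longleftrightarrow> (\<forall>j<k. j \<noteq> i \<longrightarrow> x ! j = d (Inl j))" for i x d
  \<comment> \<open>Spine \<open>i\<close> assumes that the true tuple lies in its own part and
    guesses from a member matching its view. If there is none it guesses \<open>0\<close>, a legal
    colour since \<open>q > 0\<close>.\<close>
  define guess_spine where "guess_spine i d =
      (if \<exists>x \<in> Q (\<lambda>j. d (Inr j)) i. agrees i x d
       then (SOME x. x \<in> Q (\<lambda>j. d (Inr j)) i \<and> agrees i x d) ! i else 0)"
    for i and d :: "nat + nat \<Rightarrow> nat"
  define guess_page where "guess_page j d =
      (if j < N \<and> map (\<lambda>i. d (Inl i)) [0..<k] \<in> T then e j (map (\<lambda>i. d (Inl i)) [0..<k]) else 0)"
    for j and d :: "nat + nat \<Rightarrow> nat"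
  define g where "g = case_sum guess_spine guess_page"
  have strat: "strategy (book k n) q g" if n: "n \<ge> N" for n
    unfolding strategy_def
  proof (intro ballI funcsetI)
    fix v d
    assume v: "v \<in> verts (book k n)" and d: "d \<in> nbhd (book k n) v \<rightarrow>\<^sub>E {..<q}"
    show "g v d \<in> {..<q}"
    proof (cases v)
      case (Inl i)
      then have i: "i < k"
        using v by (auto simp: verts_book)
      \<comment> \<open>Only for page colours below \<open>q\<close> is \<open>Q\<close> known to
        cover \<open>R\<close>, which bounds the entries of the selected tuple.\<close>
      have *: "\<forall>j<N. d (Inr j) < q"
        using d n Inl by (auto simp: nbhd_spine[OF i])
      have less: "x ! i < q" if "x \<in> Q (\<lambda>j. d (Inr j)) i" for x
      proof -
        have "x \<in> R (\<lambda>j. d (Inr j))"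
          using Q(1)[OF *] i that by auto
        then have "length x = k" "set x \<subseteq> {..<q}"
          by (auto simp: R_def T_def)
        then show ?thesis
          using i nth_mem by fastforce
      qed
      show ?thesis
        unfolding g_def Inl guess_spine_def using q less
        by simp (metis (mono_tags, lifting) someI_ex)
    next
      case (Inr j)
      then show ?thesis
        using q eF by (simp add: g_def guess_page_def)
    qed
  qed
  have win: "winning (book k n) q g" if n: "n \<ge> N" for n
    unfolding winning_def
  proof (intro allI impI, rule ccontr)
    fix c
    assume "proper_colouring (book k n) q c"
      and "\<not> (\<exists>v\<in>verts (book k n). g v (restrict c (nbhd (book k n) v)) = c v)"
    then have c: "\<And>v. v \<in> verts (book k n) \<Longrightarrow> c v < q" "c \<in> extensional (verts (book k n))"
        "\<And>i j. i < k \<Longrightarrow> j < k \<Longrightarrow> i \<noteq> j \<Longrightarrow> c (Inl i) \<noteq> c (Inl j)"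
        "\<And>i j. i < k \<Longrightarrow> j < n \<Longrightarrow> c (Inl i) \<noteq> c (Inr j)"
      and wrong: "\<And>v. v \<in> verts (book k n) \<Longrightarrow> g v (restrict c (nbhd (book k n) v)) \<noteq> c v"
      unfolding proper_colouring_book_iff by (auto simp: PiE_iff)
    define t where "t = map (\<lambda>i. c (Inl i)) [0..<k]"
    have t_nth: "t ! i = c (Inl i)" if "i < k" for i
      using that by (simp add: t_def)
    have "inj_on (\<lambda>i. c (Inl i)) {..<k}"
      using c(3) by (meson inj_onI lessThan_iff)
    then have tT: "t \<in> T"
      using c(1) by (auto simp: T_def t_def distinct_map verts_book atLeast0LessThan)
    define p where "p j = c (Inr j)" for j
    have p: "\<forall>j<N. p j < q"
      using c(1) n by (auto simp: p_def verts_book)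
    have "t \<in> R p"
    proof -
      have "p j \<notin> set t" if "j < N" for j
        using c(4)[of _ j] that n by (auto simp: t_def p_def dest!: sym[of "c (Inr j)"])
      moreover have "e j t \<noteq> p j" if j: "j < N" for j
      proof -
        have jn: "j < n"
          using j n by simp
        have "map (\<lambda>i. restrict c (nbhd (book k n) (Inr j)) (Inl i)) [0..<k] = t"
          using jn by (auto simp: nbhd_page t_def)
        then show ?thesis
          using wrong[of "Inr j"] jn j tT by (simp add: g_def guess_page_def verts_book p_def)
      qed
      ultimately show ?thesis
        using tT by (simp add: R_def)
    qed
    then obtain i where i: "i < k" "t \<in> Q p i"
      using Q(1)[OF p] by auto
    define d where "d = restrict c (nbhd (book k n) (Inl i))"
    \<comment> \<open>This is needed for every \<open>j\<close>, because \<open>Q\<close> takes the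
      whole function as argument. For \<open>j\<close> beyond the pages both sides are
      \<open>undefined\<close>, as \<open>c\<close> is extensional.\<close>
    have "d (Inr j) = p j" for j
      using c(2) by (auto simp: d_def p_def nbhd_spine[OF i(1)] verts_book extensional_def)
    then have dp: "(\<lambda>j. d (Inr j)) = p"
      by blast
    have agrees: "agrees i x d \<longleftrightarrow> (\<forall>j<k. j \<noteq> i \<longrightarrow> x ! j = t ! j)" for x
      by (auto simp: agrees_def d_def nbhd_spine[OF i(1)] t_nth)
    \<comment> \<open>Saturation of the part leaves \<open>t\<close> as the only candidate, so the
      choice made by spine \<open>i\<close> is the true tuple.\<close>
    have uniq: "x = t" if x: "x \<in> Q p i" "agrees i x d" for x
    proof -
      have "x \<in> R p"
        using Q(1)[OF p] i(1) x(1) by auto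
      then have "length x = k" "length t = k"
        using tT by (auto simp: R_def T_def)
      then have "delete_coord i x = delete_coord i t"
        using x(2) agrees delete_coord_eq_iff i(1) by blast
      then show ?thesis
        using Q(2)[OF p i(1)] x(1) i(2) by (auto simp: saturated_def dest: inj_onD)
    qed
    have "(SOME x. x \<in> Q p i \<and> agrees i x d) = t"
      using i(2) uniq agrees by (intro some_equality) auto
    then have "g (Inl i) d = c (Inl i)"
      using i agrees[of t] by (auto simp: g_def guess_spine_def dp t_nth)
    then show False
      using wrong[of "Inl i"] i(1) by (simp add: d_def verts_book)
  qed
  show ?thesis
    using strat win unfolding q_def by blast
qed

section \<open>From the two bounds to the supremum\<close>

theorem theorem1p1:
  fixes k :: nat
  assumes "k \<ge> 2"
  shows "(SUP n\<in>{1::nat..}. HGP (book k n)) = enat (C k) \<and>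
         (\<exists>N::nat. \<forall>n\<ge>N. HGP (book k n) = enat (C k))"
proof -
  have k: "k \<ge> 1"
    using assms by simp
  have le: "HGP (book k n) \<le> enat (C k)" for n
    unfolding HGP_def using winning_book_le_C[OF k] by (auto intro!: Sup_least)
  obtain N where N: "\<forall>n\<ge>N. \<exists>g. strategy (book k n) (C k) g \<and> winning (book k n) (C k) g"
    using winning_book_C[OF k] by blast
  have eq: "HGP (book k n) = enat (C k)" if "n \<ge> N" for n
  proof (rule antisym[OF le])
    show "enat (C k) \<le> HGP (book k n)"
      unfolding HGP_def using N that by (auto intro!: Sup_upper)
  qed
  have "(SUP n\<in>{1::nat..}. HGP (book k n)) = enat (C k)"
  proof (rule antisym)
    show "(SUP n\<in>{1::nat..}. HGP (book k n)) \<le> enat (C k)"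
      by (intro SUP_least le)
    show "enat (C k) \<le> (SUP n\<in>{1::nat..}. HGP (book k n))"
      \<comment> \<open>The index \<open>Suc N\<close> serves instead of \<open>N\<close> because
        \<open>N\<close> may be \<open>0\<close>, which lies outside the range of the
        supremum.\<close>
      using eq[of "Suc N"] SUP_upper[of "Suc N" "{1::nat..}" "\<lambda>n. HGP (book k n)"] by simp
  qed
  then show ?thesis
    using eq by blast
qed

end
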